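(* Let $X$ be a diffeological space, $P\to X$ a principal $H_\sigma$-bundle with transition functions $h_{ij}=(g_{ij},\varepsilon_{ij}):U_{ij}\to H_\sigma=G\rtimes_\sigma\mathbb Z_2$ over a good cover $(U_i)$, and let $\widehat g_{ij}:U_{ij}\to\widehat G$ be local lifts of $g_{ij}$, i.e. $q(\widehat g_{ij})=g_{ij}$. Then the family $$a_{ijk}:=\widehat g_{ij}\,\widehat\sigma^{\varepsilon_{ij}}(\widehat g_{jk})\,\widehat g_{ik}^{-1}$$ defines a Čech $2$-cocycle with coefficients in the local system $A_\alpha$, where $\alpha=[\varepsilon_{ij}]\in H^1(X;\mathbb Z_2)$.
   Context: Let $1\to A\to\widehat G\xrightarrow{q}G\to1$ be a central extension of diffeological groups with $A$ abelian. Let $\sigma:\mathbb Z_2\to\operatorname{Aut}(G)$ be a smooth action ($\mathbb Z_2=\{\pm1\}$), lifting to an action $\widehat\sigma:\mathbb Z_2\to\operatorname{Aut}(\widehat G)$ with $q\circ\widehat\sigma^\varepsilon=\sigma^\varepsilon\circ q$ for all $\varepsilon$. $H_\sigma=G\rtimes_\sigma\mathbb Z_2$ has product $(g,\varepsilon)(g',\varepsilon')=(g\,\sigma^\varepsilon(g'),\varepsilon\varepsilon')$. The transition functions satisfy $h_{ij}h_{jk}=h_{ik}$ on $U_{ijk}=U_i\cap U_j\cap U_k$, i.e. $\varepsilon_{ij}\varepsilon_{jk}=\varepsilon_{ik}$ and $g_{ij}\sigma^{\varepsilon_{ij}}(g_{jk})=g_{ik}$. The cover is taken such that smooth lifts $\widehat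 g_{ij}$ exist. $A_\alpha$ is the local system with fibre $A$ obtained by gluing $U_i\times A$ along $U_{ij}$ by the automorphisms $\widehat\sigma^{\varepsilon_{ij}}|_A$. A Čech $2$-cocycle with coefficients in $A_\alpha$ is a family of smooth maps $a_{ijk}:U_{ijk}\to A$ such that $a_{ijk}\,a_{ikl}=\widehat\sigma^{\varepsilon_{ij}}(a_{jkl})\,a_{ijl}$ on every quadruple intersection $U_{ijkl}$. *)

theory Defs
  imports "HOL-Analysis.Analysis" "HOL-Algebra.Coset" "HOL-Algebra.Bij"
begin

section \<open>Smooth functions on open subsets of Cartesian spaces\<close>

text \<open>
  The dimension of the domain of a plot varies, so \<open>R^n\<close> is \<^const>\<open>Euclidean_space\<close>, whose points are
  the functions \<^typ>\<open>nat \<Rightarrow> real\<close> that vanish at all arguments \<open>\<ge> n\<close>.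
\<close>

abbreviation open_domain :: "nat \<Rightarrow> (nat \<Rightarrow> real) set \<Rightarrow> bool" where
  "open_domain n U \<equiv> openin (Euclidean_space n) U"

definition partial_deriv :: "nat \<Rightarrow> ((nat \<Rightarrow> real) \<Rightarrow> real) \<Rightarrow> (nat \<Rightarrow> real) \<Rightarrow> real" where
  "partial_deriv i f x = deriv (\<lambda>t. f (x(i := t))) (x i)"

text \<open>Class \<open>C^k\<close>: all iterated partial derivatives of order at most \<open>k\<close> exist and are continuous.\<close>

fun C_k_on :: "nat \<Rightarrow> nat \<Rightarrow> (nat \<Rightarrow> real) set \<Rightarrow> ((nat \<Rightarrow> real) \<Rightarrow> real) \<Rightarrow> bool" where
  "C_k_on 0 n U f = continuous_map (subtopology (Euclidean_space n) U) euclideanreal f"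
| "C_k_on (Suc k) n U f =
    (continuous_map (subtopology (Euclidean_space n) U) euclideanreal f \<and>
     (\<forall>i<n. (\<forall>x\<in>U. (\<lambda>t. f (x(i := t))) differentiable (at (x i))) \<and>
            C_k_on k n U (partial_deriv i f)))"

definition C_infinity_on :: "nat \<Rightarrow> (nat \<Rightarrow> real) set \<Rightarrow> ((nat \<Rightarrow> real) \<Rightarrow> real) \<Rightarrow> bool" where
  "C_infinity_on n U f \<longleftrightarrow> (\<forall>k. C_k_on k n U f)"

section \<open>Diffeological spaces\<close>

text \<open>
  \<open>plot D n U p\<close> says that the restriction of \<open>p\<close> to the open set \<open>U\<close> of \<open>R^n\<close> is a plot;
  the values of \<open>p\<close> outside \<open>U\<close> are irrelevant (axiom \<open>plot_cong\<close>).
\<close>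

record 'a diffeology =
  points :: "'a set"
  plot :: "nat \<Rightarrow> (nat \<Rightarrow> real) set \<Rightarrow> ((nat \<Rightarrow> real) \<Rightarrow> 'a) \<Rightarrow> bool"

locale diffeological_space =
  fixes D :: "'a diffeology"
  assumes plot_domain: "plot D n U p \<Longrightarrow> open_domain n U"
    and plot_range: "plot D n U p \<Longrightarrow> p \<in> U \<rightarrow> points D"
    and plot_cong: "plot D n U p \<Longrightarrow> (\<And>u. u \<in> U \<Longrightarrow> p u = p' u) \<Longrightarrow> plot D n U p'"
    and plot_const: "open_domain n U \<Longrightarrow> c \<in> points D \<Longrightarrow> plot D n U (\<lambda>_. c)"
    and plot_local: "open_domain n U \<Longrightarrow> p \<in> U \<rightarrow> points D \<Longrightarrow>
        (\<And>u. u \<in> U \<Longrightarrow> \<exists>V. u \<in> V \<and> V \<subseteq> U \<and> plot D n V p) \<Longrightarrow> plot D n U p"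
    and plot_compose: "plot D n U p \<Longrightarrow> open_domain m V \<Longrightarrow> f \<in> V \<rightarrow> U \<Longrightarrow>
        (\<And>i. i < n \<Longrightarrow> C_infinity_on m V (\<lambda>v. f v i)) \<Longrightarrow> plot D m V (p \<circ> f)"

definition smooth_map :: "'a diffeology \<Rightarrow> 'b diffeology \<Rightarrow> ('a \<Rightarrow> 'b) \<Rightarrow> bool" where
  "smooth_map D E f \<longleftrightarrow> f \<in> points D \<rightarrow> points E \<and>
     (\<forall>n U p. plot D n U p \<longrightarrow> plot E n U (f \<circ> p))"

definition diffeomorphism :: "'a diffeology \<Rightarrow> 'b diffeology \<Rightarrow> ('a \<Rightarrow> 'b) \<Rightarrow> bool" where
  "diffeomorphism D E f \<longleftrightarrow> bij_betw f (points D) (points E) \<and>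
     smooth_map D E f \<and> smooth_map E D (inv_into (points D) f)"

definition induction :: "'a diffeology \<Rightarrow> 'b diffeology \<Rightarrow> ('a \<Rightarrow> 'b) \<Rightarrow> bool" where
  "induction D E f \<longleftrightarrow> f \<in> points D \<rightarrow> points E \<and> inj_on f (points D) \<and>
     (\<forall>n U p. plot D n U p \<longleftrightarrow> p \<in> U \<rightarrow> points D \<and> plot E n U (f \<circ> p))"

definition subduction :: "'a diffeology \<Rightarrow> 'b diffeology \<Rightarrow> ('a \<Rightarrow> 'b) \<Rightarrow> bool" where
  "subduction D E f \<longleftrightarrow> smooth_map D E f \<and> f ` points D = points E \<and>
     (\<forall>n U p. plot E n U p \<longrightarrow>
        (\<forall>u\<in>U. \<exists>V p'. u \<in> V \<and> V \<subseteq> U \<and> plot D n V p' \<and> (\<forall>v\<in>V. f (p' v) = p v)))"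

definition subspace_diffeology :: "'a diffeology \<Rightarrow> 'a set \<Rightarrow> 'a diffeology" where
  "subspace_diffeology D S =
     \<lparr>points = points D \<inter> S, plot = \<lambda>n U p. plot D n U p \<and> p \<in> U \<rightarrow> S\<rparr>"

definition prod_diffeology :: "'a diffeology \<Rightarrow> 'b diffeology \<Rightarrow> ('a \<times> 'b) diffeology" where
  "prod_diffeology D E =
     \<lparr>points = points D \<times> points E,
      plot = \<lambda>n U p. plot D n U (fst \<circ> p) \<and> plot E n U (snd \<circ> p)\<rparr>"

text \<open>Discrete diffeology: the plots are the locally constant parametrizations.\<close>

definition discrete_diffeology :: "'a set \<Rightarrow> 'a diffeology" where
  "discrete_diffeology S =
     \<lparr>points = S,
      plot = \<lambda>n U p. open_domain n U \<and> p \<in> U \<rightarrow> S \<and>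
        (\<forall>u\<in>U. \<exists>V. open_domain n V \<and> u \<in> V \<and> V \<subseteq> U \<and> (\<forall>v\<in>V. p v = p u))\<rparr>"

definition real_diffeology :: "real diffeology" where
  "real_diffeology =
     \<lparr>points = UNIV, plot = \<lambda>n U p. open_domain n U \<and> C_infinity_on n U p\<rparr>"

definition D_open :: "'a diffeology \<Rightarrow> 'a set \<Rightarrow> bool" where
  "D_open D S \<longleftrightarrow> S \<subseteq> points D \<and>
     (\<forall>n U p. plot D n U p \<longrightarrow> open_domain n {u\<in>U. p u \<in> S})"

definition smoothly_contractible :: "'a diffeology \<Rightarrow> bool" where
  "smoothly_contractible D \<longleftrightarrow>
     (\<exists>c\<in>points D. \<exists>F. smooth_map (prod_diffeology real_diffeology D) D F \<and>
        (\<forall>x\<in>points D. F (0, x) = x \<and> F (1, x) = c))"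

definition good_cover :: "'x diffeology \<Rightarrow> 'i set \<Rightarrow> ('i \<Rightarrow> 'x set) \<Rightarrow> bool" where
  "good_cover X I U \<longleftrightarrow> (\<forall>i\<in>I. D_open X (U i)) \<and> (\<Union>i\<in>I. U i) = points X \<and>
     (\<forall>J. J \<subseteq> I \<and> finite J \<and> J \<noteq> {} \<and> (\<Inter>j\<in>J. U j) \<noteq> {} \<longrightarrow>
        smoothly_contractible (subspace_diffeology X (\<Inter>j\<in>J. U j)))"

section \<open>Diffeological groups, actions, extensions\<close>

locale diffeological_group = group G + diffeological_space D
  for G :: "'g monoid" (structure) and D :: "'g diffeology" +
  assumes points_eq_carrier: "points D = carrier G"
    and smooth_mult: "smooth_map (prod_diffeology D D) D (\<lambda>(x, y). x \<otimes> y)"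
    and smooth_inv: "smooth_map D D (\<lambda>x. inv x)"

definition central_extension ::
  "'a monoid \<Rightarrow> 'a diffeology \<Rightarrow> 'e monoid \<Rightarrow> 'e diffeology \<Rightarrow> 'g monoid \<Rightarrow> 'g diffeology \<Rightarrow>
   ('a \<Rightarrow> 'e) \<Rightarrow> ('e \<Rightarrow> 'g) \<Rightarrow> bool" where
  "central_extension A D\<^sub>A E D\<^sub>E G D\<^sub>G \<iota> q \<longleftrightarrow>
     diffeological_group A D\<^sub>A \<and> diffeological_group E D\<^sub>E \<and> diffeological_group G D\<^sub>G \<and>
     comm_group A \<and>
     \<iota> \<in> hom A E \<and> induction D\<^sub>A D\<^sub>E \<iota> \<and>
     q \<in> hom E G \<and> subduction D\<^sub>E D\<^sub>G q \<and>
     \<iota> ` carrier A = kernel E G q \<and>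
     (\<forall>a\<in>carrier A. \<forall>x\<in>carrier E. \<iota> a \<otimes>\<^bsub>E\<^esub> x = x \<otimes>\<^bsub>E\<^esub> \<iota> a)"

definition Z2 :: "int monoid" where
  "Z2 = \<lparr>carrier = {1, - 1}, mult = (*), one = 1\<rparr>"

definition Z2_diffeology :: "int diffeology" where
  "Z2_diffeology = discrete_diffeology {1, - 1}"

text \<open>
  Smoothness of \<open>\<sigma> : Z2 \<rightarrow> Aut(G)\<close> refers to the functional diffeology, i.e. it is smoothness of
  the evaluated map on \<open>Z2 \<times> G\<close>; the inverses are then smooth too because \<open>\<sigma>\<close> is a homomorphism.
\<close>

definition smooth_Z2_action :: "'g monoid \<Rightarrow> 'g diffeology \<Rightarrow> (int \<Rightarrow> 'g \<Rightarrow> 'g) \<Rightarrow> bool" where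
  "smooth_Z2_action G D \<sigma> \<longleftrightarrow> \<sigma> \<in> hom Z2 (AutoGroup G) \<and>
     smooth_map (prod_diffeology Z2_diffeology D) D (\<lambda>(\<epsilon>, x). \<sigma> \<epsilon> x)"

definition semidirect_Z2 :: "'g monoid \<Rightarrow> (int \<Rightarrow> 'g \<Rightarrow> 'g) \<Rightarrow> ('g \<times> int) monoid" where
  "semidirect_Z2 G \<sigma> =
     \<lparr>carrier = carrier G \<times> carrier Z2,
      mult = \<lambda>(g, \<epsilon>) (g', \<epsilon>'). (g \<otimes>\<^bsub>G\<^esub> \<sigma> \<epsilon> g', \<epsilon> * \<epsilon>'),
      one = (\<one>\<^bsub>G\<^esub>, 1)\<rparr>"

definition semidirect_Z2_diffeology :: "'g diffeology \<Rightarrow> ('g \<times> int) diffeology" where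
  "semidirect_Z2_diffeology D = prod_diffeology D Z2_diffeology"

text \<open>The automorphism of \<open>A\<close> induced by an automorphism \<open>\<tau>\<close> of the extension that preserves \<open>\<iota>(A)\<close>.\<close>

definition restrict_along :: "'a monoid \<Rightarrow> ('a \<Rightarrow> 'e) \<Rightarrow> ('e \<Rightarrow> 'e) \<Rightarrow> 'a \<Rightarrow> 'a" where
  "restrict_along A \<iota> \<tau> = (\<lambda>a\<in>carrier A. inv_into (carrier A) \<iota> (\<tau> (\<iota> a)))"

section \<open>Principal bundles and transition functions\<close>

definition local_trivialization ::
  "'h monoid \<Rightarrow> 'h diffeology \<Rightarrow> 'p diffeology \<Rightarrow> 'x diffeology \<Rightarrow> ('p \<Rightarrow> 'x) \<Rightarrow> ('p \<Rightarrow> 'h \<Rightarrow> 'p) \<Rightarrow>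
   'x set \<Rightarrow> ('x \<times> 'h \<Rightarrow> 'p) \<Rightarrow> bool" where
  "local_trivialization H D\<^sub>H P X \<pi> act U \<phi> \<longleftrightarrow>
     diffeomorphism (prod_diffeology (subspace_diffeology X U) D\<^sub>H)
       (subspace_diffeology P {p. \<pi> p \<in> U}) \<phi> \<and>
     (\<forall>x\<in>U. \<forall>h\<in>carrier H. \<pi> (\<phi> (x, h)) = x \<and>
        (\<forall>k\<in>carrier H. act (\<phi> (x, h)) k = \<phi> (x, h \<otimes>\<^bsub>H\<^esub> k)))"

definition principal_bundle ::
  "'h monoid \<Rightarrow> 'h diffeology \<Rightarrow> 'p diffeology \<Rightarrow> 'x diffeology \<Rightarrow> ('p \<Rightarrow> 'x) \<Rightarrow> ('p \<Rightarrow> 'h \<Rightarrow> 'p) \<Rightarrow> bool" where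
  "principal_bundle H D\<^sub>H P X \<pi> act \<longleftrightarrow>
     diffeological_group H D\<^sub>H \<and> diffeological_space P \<and> diffeological_space X \<and>
     smooth_map P X \<pi> \<and>
     smooth_map (prod_diffeology P D\<^sub>H) P (\<lambda>(p, h). act p h) \<and>
     (\<forall>p\<in>points P. act p \<one>\<^bsub>H\<^esub> = p) \<and>
     (\<forall>p\<in>points P. \<forall>h\<in>carrier H. \<forall>k\<in>carrier H. act (act p h) k = act p (h \<otimes>\<^bsub>H\<^esub> k)) \<and>
     (\<forall>p\<in>points P. \<forall>h\<in>carrier H. \<pi> (act p h) = \<pi> p) \<and>
     (\<forall>x\<in>points X. \<exists>U \<phi>. D_open X U \<and> x \<in> U \<and> local_trivialization H D\<^sub>H P X \<pi> act U \<phi>)"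

text \<open>
  With the sections \<open>s\<^sub>i x = \<phi> i (x, \<one>)\<close> the convention is \<open>s\<^sub>j = s\<^sub>i \<cdot> h\<^sub>i\<^sub>j\<close>, which gives
  \<open>h\<^sub>i\<^sub>j h\<^sub>j\<^sub>k = h\<^sub>i\<^sub>k\<close>. Smoothness of \<open>h\<^sub>i\<^sub>j\<close> and this cocycle identity follow from the definition.
\<close>

definition transition_functions ::
  "'h monoid \<Rightarrow> 'h diffeology \<Rightarrow> 'p diffeology \<Rightarrow> 'x diffeology \<Rightarrow> ('p \<Rightarrow> 'x) \<Rightarrow> ('p \<Rightarrow> 'h \<Rightarrow> 'p) \<Rightarrow>
   'i set \<Rightarrow> ('i \<Rightarrow> 'x set) \<Rightarrow> ('i \<Rightarrow> 'x \<times> 'h \<Rightarrow> 'p) \<Rightarrow> ('i \<Rightarrow> 'i \<Rightarrow> 'x \<Rightarrow> 'h) \<Rightarrow> bool" where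
  "transition_functions H D\<^sub>H P X \<pi> act I U \<phi> h \<longleftrightarrow>
     (\<forall>i\<in>I. local_trivialization H D\<^sub>H P X \<pi> act (U i) (\<phi> i)) \<and>
     (\<forall>i\<in>I. \<forall>j\<in>I. \<forall>x\<in>U i \<inter> U j. h i j x \<in> carrier H \<and>
        (\<forall>k\<in>carrier H. \<phi> j (x, k) = \<phi> i (x, h i j x \<otimes>\<^bsub>H\<^esub> k)))"

section \<open>Cech cocycles and local systems\<close>

definition cech_Z2_1_cocycle ::
  "'x diffeology \<Rightarrow> 'i set \<Rightarrow> ('i \<Rightarrow> 'x set) \<Rightarrow> ('i \<Rightarrow> 'i \<Rightarrow> 'x \<Rightarrow> int) \<Rightarrow> bool" where
  "cech_Z2_1_cocycle X I U \<epsilon> \<longleftrightarrow>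
     (\<forall>i\<in>I. \<forall>j\<in>I. smooth_map (subspace_diffeology X (U i \<inter> U j)) Z2_diffeology (\<epsilon> i j)) \<and>
     (\<forall>i\<in>I. \<forall>j\<in>I. \<forall>k\<in>I. \<forall>x\<in>U i \<inter> U j \<inter> U k. \<epsilon> i j x * \<epsilon> j k x = \<epsilon> i k x)"

text \<open>
  A local system with fibre \<open>A\<close>, trivialised over the \<open>U i\<close>, is presented by its gluing
  automorphisms \<open>\<theta> i j x\<close>, locally constant in \<open>x\<close>; \<open>\<theta> i j x\<close> carries the
  fibre coordinate over \<open>U j\<close> to the one over \<open>U i\<close>.
\<close>

definition local_system ::
  "'x diffeology \<Rightarrow> 'i set \<Rightarrow> ('i \<Rightarrow> 'x set) \<Rightarrow> 'a monoid \<Rightarrow> 'a diffeology \<Rightarrow>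
   ('i \<Rightarrow> 'i \<Rightarrow> 'x \<Rightarrow> 'a \<Rightarrow> 'a) \<Rightarrow> bool" where
  "local_system X I U A D \<theta> \<longleftrightarrow>
     (\<forall>i\<in>I. \<forall>j\<in>I.
        smooth_map (subspace_diffeology X (U i \<inter> U j))
          (discrete_diffeology {\<tau> \<in> auto A. diffeomorphism D D \<tau>}) (\<theta> i j)) \<and>
     (\<forall>i\<in>I. \<forall>j\<in>I. \<forall>k\<in>I. \<forall>x\<in>U i \<inter> U j \<inter> U k. \<forall>a\<in>carrier A.
        \<theta> i j x (\<theta> j k x a) = \<theta> i k x a)"

text \<open>The gluing automorphisms of \<open>A\<^sub>\<alpha>\<close>, with \<open>\<alpha>\<close> represented by the 1-cocycle \<open>\<epsilon>\<close>.\<close>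

definition twisted_gluing ::
  "'a monoid \<Rightarrow> ('a \<Rightarrow> 'e) \<Rightarrow> (int \<Rightarrow> 'e \<Rightarrow> 'e) \<Rightarrow> ('i \<Rightarrow> 'i \<Rightarrow> 'x \<Rightarrow> int) \<Rightarrow>
   'i \<Rightarrow> 'i \<Rightarrow> 'x \<Rightarrow> 'a \<Rightarrow> 'a" where
  "twisted_gluing A \<iota> \<sigma> \<epsilon> = (\<lambda>i j x. restrict_along A \<iota> (\<sigma> (\<epsilon> i j x)))"

definition cech_2_cocycle ::
  "'x diffeology \<Rightarrow> 'i set \<Rightarrow> ('i \<Rightarrow> 'x set) \<Rightarrow> 'a monoid \<Rightarrow> 'a diffeology \<Rightarrow>
   ('i \<Rightarrow> 'i \<Rightarrow> 'x \<Rightarrow> 'a \<Rightarrow> 'a) \<Rightarrow> ('i \<Rightarrow> 'i \<Rightarrow> 'i \<Rightarrow> 'x \<Rightarrow> 'a) \<Rightarrow> bool" where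
  "cech_2_cocycle X I U A D \<theta> a \<longleftrightarrow>
     (\<forall>i\<in>I. \<forall>j\<in>I. \<forall>k\<in>I. smooth_map (subspace_diffeology X (U i \<inter> U j \<inter> U k)) D (a i j k)) \<and>
     (\<forall>i\<in>I. \<forall>j\<in>I. \<forall>k\<in>I. \<forall>l\<in>I. \<forall>x\<in>U i \<inter> U j \<inter> U k \<inter> U l.
        a i j k x \<otimes>\<^bsub>A\<^esub> a i k l x = \<theta> i j x (a j k l x) \<otimes>\<^bsub>A\<^esub> a i j l x)"

end

theory Submission
  imports Defs
begin

text \<open>
  Write \<open>s\<^sub>i\<^sub>j\<close> for the automorphism of the extension group given by \<open>\<epsilon>\<^sub>i\<^sub>j\<close> and
  \<open>c\<^sub>i\<^sub>j\<^sub>k = g\<^sub>i\<^sub>j s\<^sub>i\<^sub>j(g\<^sub>j\<^sub>k) g\<^sub>i\<^sub>k\<^sup>-\<^sup>1\<close>, with \<open>g\<^sub>i\<^sub>j\<close> now denoting the lifts.  The factor \<open>c\<^sub>i\<^sub>j\<^sub>k\<close> is the failure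
  of the pairs \<open>(g\<^sub>i\<^sub>j, \<epsilon>\<^sub>i\<^sub>j)\<close> to satisfy the cocycle identity of the bundle, so it dies under
  \<open>q\<close> and lies in the image of the central subgroup \<open>A\<close>; the induction \<open>\<iota>\<close> makes the
  resulting \<open>A\<close>-valued function smooth (\<open>smooth_map_lift_along_induction\<close>).

  The 2-cocycle identity is associativity of the twisted product.  Expanding
  \<open>g\<^sub>i\<^sub>j s\<^sub>i\<^sub>j(g\<^sub>j\<^sub>k) s\<^sub>i\<^sub>k(g\<^sub>k\<^sub>l)\<close> from the left produces \<open>c\<^sub>i\<^sub>j\<^sub>k c\<^sub>i\<^sub>k\<^sub>l g\<^sub>i\<^sub>l\<close>.  Since \<open>s\<^sub>i\<^sub>k = s\<^sub>i\<^sub>j s\<^sub>j\<^sub>k\<close>,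
  expanding it from the right produces \<open>g\<^sub>i\<^sub>j s\<^sub>i\<^sub>j(c\<^sub>j\<^sub>k\<^sub>l) s\<^sub>i\<^sub>j(g\<^sub>j\<^sub>l)\<close>, and as \<open>s\<^sub>i\<^sub>j(c\<^sub>j\<^sub>k\<^sub>l)\<close> is central
  this is \<open>s\<^sub>i\<^sub>j(c\<^sub>j\<^sub>k\<^sub>l) c\<^sub>i\<^sub>j\<^sub>l g\<^sub>i\<^sub>l\<close> (\<open>twisted_coboundary\<close>).

  That the \<open>\<epsilon>\<^sub>i\<^sub>j\<close> form a smooth 1-cocycle is read off from the bundle: comparing two trivializations
  along the unit section expresses \<open>h\<^sub>i\<^sub>j\<close> through \<open>\<phi>\<^sub>i\<^sup>-\<^sup>1\<close> and \<open>\<phi>\<^sub>j\<close>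
  (\<open>transition_function_smooth\<close>), and injectivity of \<open>\<phi>\<^sub>i\<close> gives the
  cocycle identity.  The gluing maps \<open>s\<^sub>i\<^sub>j|A\<close> then inherit the cocycle identity from
  \<open>\<epsilon>\<close>, and are locally constant because \<open>\<epsilon>\<close> takes values in a discrete space.
\<close>

section \<open>Smooth maps between diffeological spaces\<close>

lemma smooth_mapD:
  assumes "smooth_map D E f"
  shows "x \<in> points D \<Longrightarrow> f x \<in> points E"
    and "plot D n U p \<Longrightarrow> plot E n U (f \<circ> p)"
  using assms by (auto simp: smooth_map_def)

lemma smooth_map_compose:
  assumes "smooth_map D E f" "smooth_map E F k"
  shows "smooth_map D F (\<lambda>x. k (f x))"
proof -
  have "plot F n U ((\<lambda>x. k (f x)) \<circ> p)" if "plot D n U p" for n U p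
    using smooth_mapD(2)[OF assms(2) smooth_mapD(2)[OF assms(1) that]] by (simp add: comp_def)
  then show ?thesis
    using assms by (auto simp: smooth_map_def Pi_iff)
qed

lemma smooth_map_cong:
  assumes "diffeological_space D" "diffeological_space E" "smooth_map D E f"
    and eq: "\<And>x. x \<in> points D \<Longrightarrow> f x = f' x"
  shows "smooth_map D E f'"
proof -
  have "plot E n U (f' \<circ> p)" if p: "plot D n U p" for n U p
  proof (rule diffeological_space.plot_cong[OF assms(2)])
    show "plot E n U (f \<circ> p)"
      by (rule smooth_mapD(2)[OF assms(3) p])
    show "(f \<circ> p) u = (f' \<circ> p) u" if "u \<in> U" for u
      using diffeological_space.plot_range[OF assms(1) p] that eq by auto
  qed
  moreover have "f' \<in> points D \<rightarrow> points E"
    using smooth_mapD(1)[OF assms(3)] eq by auto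
  ultimately show ?thesis
    by (simp add: smooth_map_def)
qed

lemma smooth_map_id: "smooth_map D D (\<lambda>x. x)"
  by (simp add: smooth_map_def comp_def)

lemma smooth_map_const:
  assumes "diffeological_space D" "diffeological_space E" "c \<in> points E"
  shows "smooth_map D E (\<lambda>_. c)"
  using diffeological_space.plot_const[OF assms(2) _ assms(3)]
    diffeological_space.plot_domain[OF assms(1)] assms(3)
  by (auto simp: smooth_map_def comp_def)

lemma smooth_map_Pair:
  assumes "smooth_map D E f" "smooth_map D F k"
  shows "smooth_map D (prod_diffeology E F) (\<lambda>x. (f x, k x))"
  using assms by (auto simp: smooth_map_def prod_diffeology_def comp_def)

lemma smooth_map_snd: "smooth_map (prod_diffeology D E) E snd"
  by (auto simp: smooth_map_def prod_diffeology_def)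

lemma smooth_map_subspace_inclusion: "smooth_map (subspace_diffeology D S) D (\<lambda>x. x)"
  by (simp add: smooth_map_def subspace_diffeology_def comp_def)

lemma smooth_map_into_subspace:
  assumes "diffeological_space D" "smooth_map D E f" "f \<in> points D \<rightarrow> S"
  shows "smooth_map D (subspace_diffeology E S) f"
proof -
  have "f \<circ> p \<in> U \<rightarrow> S" if "plot D n U p" for n U p
    using diffeological_space.plot_range[OF assms(1) that] assms(3) by auto
  then show ?thesis
    using assms(2,3) by (auto simp: smooth_map_def subspace_diffeology_def)
qed

lemma smooth_map_subspace_mono:
  assumes "smooth_map (subspace_diffeology D T) E f" "S \<subseteq> T"
  shows "smooth_map (subspace_diffeology D S) E f"
proof -
  have "p \<in> U \<rightarrow> T" if "p \<in> U \<rightarrow> S" for U :: "(nat \<Rightarrow> real) set" and p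
    using that assms(2) by blast
  then show ?thesis
    using assms by (auto simp: smooth_map_def subspace_diffeology_def Pi_iff)
qed

lemma diffeological_space_subspace:
  assumes "diffeological_space D"
  shows "diffeological_space (subspace_diffeology D S)"
proof -
  interpret diffeological_space D by fact
  show ?thesis
  proof (unfold_locales, goal_cases)
    case (1 n U p)
    then show ?case using plot_domain by (auto simp: subspace_diffeology_def)
  next
    case (2 n U p)
    then show ?case using plot_range by (fastforce simp: subspace_diffeology_def)
  next
    case (3 n U p p')
    then show ?case using plot_cong[of n U p p'] by (auto simp: subspace_diffeology_def Pi_iff)
  next
    case (4 n U c)
    then show ?case using plot_const by (auto simp: subspace_diffeology_def)
  next
    case (5 n U p)
    have "plot D n U p"
    proof (rule plot_local)
      show "\<exists>V. u \<in> V \<and> V \<subseteq> U \<and> plot D n V p" if "u \<in> U" for u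
        using 5(3)[OF that] by (auto simp: subspace_diffeology_def)
    qed (use 5 in \<open>auto simp: subspace_diffeology_def\<close>)
    then show ?case using 5(2) by (auto simp: subspace_diffeology_def)
  next
    case (6 n U p m V f)
    then show ?case using plot_compose[of n U p m V f]
      by (auto simp: subspace_diffeology_def Pi_iff)
  qed
qed

text \<open>
  An induction pulls the diffeology back to its source, so a smooth map that takes its values in
  the image factors smoothly.
\<close>

lemma smooth_map_lift_along_induction:
  assumes X: "diffeological_space X" and E: "diffeological_space E"
    and \<iota>: "induction D E \<iota>" and f: "smooth_map X E f"
    and into: "\<And>x. x \<in> points X \<Longrightarrow> f x \<in> \<iota> ` points D"
  shows "smooth_map X D (\<lambda>x. inv_into (points D) \<iota> (f x))"
proof -
  let ?l = "\<lambda>x. inv_into (points D) \<iota> (f x)"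
  have l: "?l x \<in> points D" "\<iota> (?l x) = f x" if "x \<in> points X" for x
    using into[OF that] by (auto simp: inv_into_into f_inv_into_f)
  have "plot D n U (?l \<circ> p)" if p: "plot X n U p" for n U p
  proof -
    have pU: "p u \<in> points X" if "u \<in> U" for u
      using diffeological_space.plot_range[OF X p] that by auto
    have "plot E n U (\<iota> \<circ> (?l \<circ> p))"
      by (rule diffeological_space.plot_cong[OF E smooth_mapD(2)[OF f p]]) (simp add: l pU)
    then show ?thesis
      using \<iota> l pU by (auto simp: induction_def)
  qed
  then show ?thesis
    using l by (auto simp: smooth_map_def)
qed

lemma smooth_map_const_discrete:
  assumes "diffeological_space D" "c \<in> S"
  shows "smooth_map D (discrete_diffeology S) (\<lambda>_. c)"
  using diffeological_space.plot_domain[OF assms(1)] assms(2)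
  by (auto simp: smooth_map_def discrete_diffeology_def)

text \<open>Every map out of a discrete space preserves local constancy.\<close>

lemma smooth_map_discrete:
  assumes "f \<in> S \<rightarrow> T"
  shows "smooth_map (discrete_diffeology S) (discrete_diffeology T) f"
proof -
  have "plot (discrete_diffeology T) n U (f \<circ> p)" if p: "plot (discrete_diffeology S) n U p" for n U p
  proof -
    have dom: "open_domain n U" and rng: "p \<in> U \<rightarrow> S"
      using p by (simp_all add: discrete_diffeology_def)
    have "\<exists>V. open_domain n V \<and> u \<in> V \<and> V \<subseteq> U \<and> (\<forall>v\<in>V. (f \<circ> p) v = (f \<circ> p) u)"
      if "u \<in> U" for u
      using p that unfolding discrete_diffeology_def diffeology.simps comp_apply by metis
    moreover have "f \<circ> p \<in> U \<rightarrow> T"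
      using rng assms by auto
    ultimately show ?thesis
      using dom by (simp add: discrete_diffeology_def)
  qed
  moreover have "f \<in> points (discrete_diffeology S) \<rightarrow> points (discrete_diffeology T)"
    using assms by (simp add: discrete_diffeology_def)
  ultimately show ?thesis
    by (simp add: smooth_map_def)
qed

section \<open>Actions of the group with two elements\<close>

lemma Z2_action_auto:
  assumes "smooth_Z2_action G D \<sigma>" "e \<in> carrier Z2"
  shows "\<sigma> e \<in> auto G"
  using assms by (auto simp: smooth_Z2_action_def AutoGroup_def hom_def)

lemma Z2_action_closed:
  assumes "smooth_Z2_action G D \<sigma>" "e \<in> carrier Z2" "x \<in> carrier G"
  shows "\<sigma> e x \<in> carrier G"
  using Z2_action_auto[OF assms(1,2)] assms(3) by (auto simp: auto_def hom_def)

lemma Z2_action_hom: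
  assumes "smooth_Z2_action G D \<sigma>" "e \<in> carrier Z2" "x \<in> carrier G" "y \<in> carrier G"
  shows "\<sigma> e (x \<otimes>\<^bsub>G\<^esub> y) = \<sigma> e x \<otimes>\<^bsub>G\<^esub> \<sigma> e y"
  using Z2_action_auto[OF assms(1,2)] assms(3,4) by (auto simp: auto_def hom_def)

lemma Z2_mult_closed: "e \<in> carrier Z2 \<Longrightarrow> e' \<in> carrier Z2 \<Longrightarrow> e * e' \<in> carrier Z2"
  by (auto simp: Z2_def)

lemma Z2_square: "e \<in> carrier Z2 \<Longrightarrow> e * e = 1"
  by (auto simp: Z2_def)

lemma Z2_one: "1 \<in> carrier Z2"
  by (simp add: Z2_def)

lemma Z2_action_mult:
  assumes act: "smooth_Z2_action G D \<sigma>" and e: "e \<in> carrier Z2" "e' \<in> carrier Z2"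
    and x: "x \<in> carrier G"
  shows "\<sigma> (e * e') x = \<sigma> e (\<sigma> e' x)"
proof -
  have "\<sigma> (e * e') = \<sigma> e \<otimes>\<^bsub>AutoGroup G\<^esub> \<sigma> e'"
    using act e hom_mult[of \<sigma> Z2 "AutoGroup G" e e'] by (simp add: smooth_Z2_action_def Z2_def)
  moreover have "\<sigma> e \<in> Bij (carrier G)" "\<sigma> e' \<in> Bij (carrier G)"
    using Z2_action_auto[OF act] e by (auto simp: auto_def)
  ultimately show ?thesis
    using x by (simp add: AutoGroup_def BijGroup_def compose_eq)
qed

lemma Z2_action_one:
  assumes "smooth_Z2_action G D \<sigma>" "x \<in> carrier G"
  shows "\<sigma> 1 x = x"
proof -
  have "inj_on (\<sigma> 1) (carrier G)"
    using Z2_action_auto[OF assms(1) Z2_one] by (auto simp: auto_def Bij_def bij_betw_def)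
  moreover have "\<sigma> 1 (\<sigma> 1 x) = \<sigma> 1 x"
    using Z2_action_mult[OF assms(1) Z2_one Z2_one assms(2)] by simp
  ultimately show ?thesis
    using Z2_action_closed[OF assms(1) Z2_one assms(2)] assms(2) by (auto dest: inj_onD)
qed

lemma smooth_map_Z2_action:
  assumes "smooth_Z2_action G D \<sigma>" "smooth_map X Z2_diffeology e" "smooth_map X D f"
  shows "smooth_map X D (\<lambda>x. \<sigma> (e x) (f x))"
proof -
  have "smooth_map (prod_diffeology Z2_diffeology D) D (\<lambda>(\<epsilon>, y). \<sigma> \<epsilon> y)"
    using assms(1) by (simp add: smooth_Z2_action_def)
  from smooth_map_compose[OF smooth_map_Pair[OF assms(2,3)] this] show ?thesis
    by simp
qed

section \<open>Central extensions with a compatible action\<close>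

locale Z2_equivariant_central_extension =
  fixes A :: "'a monoid" and D\<^sub>A :: "'a diffeology"
    and E :: "'e monoid" and D\<^sub>E :: "'e diffeology"
    and G :: "'g monoid" and D\<^sub>G :: "'g diffeology"
    and \<iota> :: "'a \<Rightarrow> 'e" and q :: "'e \<Rightarrow> 'g"
    and \<sigma> :: "int \<Rightarrow> 'g \<Rightarrow> 'g" and \<sigma>h :: "int \<Rightarrow> 'e \<Rightarrow> 'e"
  assumes extension: "central_extension A D\<^sub>A E D\<^sub>E G D\<^sub>G \<iota> q"
    and action: "smooth_Z2_action G D\<^sub>G \<sigma>"
    and action_lift: "smooth_Z2_action E D\<^sub>E \<sigma>h"
    and equivariant: "\<And>e y. e \<in> carrier Z2 \<Longrightarrow> y \<in> carrier E \<Longrightarrow> q (\<sigma>h e y) = \<sigma> e (q y)"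
begin

sublocale A: diffeological_group A D\<^sub>A
  using extension by (simp add: central_extension_def)

sublocale E: diffeological_group E D\<^sub>E
  using extension by (simp add: central_extension_def)

sublocale G: diffeological_group G D\<^sub>G
  using extension by (simp add: central_extension_def)

sublocale \<iota>: group_hom A E \<iota>
  using extension by unfold_locales (simp add: central_extension_def)

sublocale q: group_hom E G q
  using extension by unfold_locales (simp add: central_extension_def)

lemma inj_\<iota>: "inj_on \<iota> (carrier A)"
  using extension A.points_eq_carrier by (simp add: central_extension_def induction_def)

lemma image_\<iota>: "\<iota> ` carrier A = {x \<in> carrier E. q x = \<one>\<^bsub>G\<^esub>}"
  using extension by (simp add: central_extension_def kernel_def)

lemma central: "a \<in> carrier A \<Longrightarrow> x \<in> carrier E \<Longrightarrow> \<iota> a \<otimes>\<^bsub>E\<^esub> x = x \<otimes>\<^bsub>E\<^esub> \<iota> a"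
  using extension by (simp add: central_extension_def)

lemma \<sigma>h_closed: "e \<in> carrier Z2 \<Longrightarrow> y \<in> carrier E \<Longrightarrow> \<sigma>h e y \<in> carrier E"
  by (rule Z2_action_closed[OF action_lift])

lemma smooth_map_into_A:
  assumes "diffeological_space X" "smooth_map X D\<^sub>E f"
    and "\<And>x. x \<in> points X \<Longrightarrow> q (f x) = \<one>\<^bsub>G\<^esub>"
  shows "smooth_map X D\<^sub>A (\<lambda>x. inv_into (carrier A) \<iota> (f x))"
proof -
  have "induction D\<^sub>A D\<^sub>E \<iota>"
    using extension by (simp add: central_extension_def)
  moreover have "f x \<in> \<iota> ` points D\<^sub>A" if "x \<in> points X" for x
    using smooth_mapD(1)[OF assms(2) that] assms(3)[OF that]
    by (simp add: image_\<iota> A.points_eq_carrier E.points_eq_carrier)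
  ultimately show ?thesis
    using smooth_map_lift_along_induction[OF assms(1) E.diffeological_space_axioms _ assms(2), of D\<^sub>A \<iota>]
    by (simp add: A.points_eq_carrier)
qed

text \<open>The automorphism of \<open>A\<close> by which an element of the acting group twists the coefficients.\<close>

abbreviation twist :: "int \<Rightarrow> 'a \<Rightarrow> 'a" where
  "twist e \<equiv> restrict_along A \<iota> (\<sigma>h e)"

text \<open>Equivariance of \<open>q\<close> is what makes the action preserve the kernel \<open>\<iota>(A)\<close>.\<close>

lemma \<sigma>h_preserves_image:
  assumes "e \<in> carrier Z2" "a \<in> carrier A"
  shows "\<sigma>h e (\<iota> a) \<in> \<iota> ` carrier A"
proof -
  have "\<iota> a \<in> carrier E" "q (\<iota> a) = \<one>\<^bsub>G\<^esub>"
    using image_\<iota> assms(2) by auto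
  moreover have "\<sigma> e \<one>\<^bsub>G\<^esub> = \<one>\<^bsub>G\<^esub>"
  proof -
    have "group_hom G G (\<sigma> e)"
      using Z2_action_auto[OF action assms(1)] by unfold_locales (simp add: auto_def)
    then show ?thesis
      by (rule group_hom.hom_one)
  qed
  ultimately show ?thesis
    unfolding image_\<iota> using assms(1) by (simp add: \<sigma>h_closed equivariant)
qed

lemma \<iota>_twist:
  assumes "e \<in> carrier Z2" "a \<in> carrier A"
  shows "\<iota> (twist e a) = \<sigma>h e (\<iota> a)"
  using f_inv_into_f[OF \<sigma>h_preserves_image[OF assms]] assms(2) by (simp add: restrict_along_def)

lemma twist_closed:
  assumes "e \<in> carrier Z2" "a \<in> carrier A"
  shows "twist e a \<in> carrier A"
  using inv_into_into[OF \<sigma>h_preserves_image[OF assms]] assms(2) by (simp add: restrict_along_def)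

lemma \<iota>_eqD: "\<iota> a = \<iota> b \<Longrightarrow> a \<in> carrier A \<Longrightarrow> b \<in> carrier A \<Longrightarrow> a = b"
  using inj_\<iota> by (auto dest: inj_onD)

lemma twist_mult:
  assumes "e \<in> carrier Z2" "e' \<in> carrier Z2" "a \<in> carrier A"
  shows "twist (e * e') a = twist e (twist e' a)"
  by (rule \<iota>_eqD)
    (use assms in \<open>simp_all add: \<iota>_twist twist_closed Z2_mult_closed Z2_action_mult[OF action_lift]\<close>)

lemma twist_involution:
  assumes "e \<in> carrier Z2" "a \<in> carrier A"
  shows "twist e (twist e a) = a"
  by (rule \<iota>_eqD)
    (use assms in \<open>simp_all add: \<iota>_twist twist_closed Z2_square Z2_action_one[OF action_lift]
      flip: Z2_action_mult[OF action_lift]\<close>)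

lemma bij_betw_twist: "e \<in> carrier Z2 \<Longrightarrow> bij_betw (twist e) (carrier A) (carrier A)"
  by (rule bij_betwI[where g = "twist e"]) (auto simp: twist_closed twist_involution)

lemma twist_auto:
  assumes e: "e \<in> carrier Z2"
  shows "twist e \<in> auto A"
proof -
  have "twist e (a \<otimes>\<^bsub>A\<^esub> b) = twist e a \<otimes>\<^bsub>A\<^esub> twist e b"
    if "a \<in> carrier A" "b \<in> carrier A" for a b
    by (rule \<iota>_eqD) (use e that in \<open>simp_all add: \<iota>_twist twist_closed Z2_action_hom[OF action_lift]\<close>)
  moreover have "twist e \<in> extensional (carrier A)"
    by (simp add: restrict_along_def)
  ultimately show ?thesis
    using bij_betw_twist[OF e] by (auto simp: auto_def Bij_def hom_def twist_closed e)
qed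

lemma smooth_twist:
  assumes e: "e \<in> carrier Z2"
  shows "smooth_map D\<^sub>A D\<^sub>A (twist e)"
proof (rule smooth_map_cong)
  have \<iota>: "smooth_map D\<^sub>A D\<^sub>E \<iota>"
    using extension by (auto simp: central_extension_def induction_def smooth_map_def)
  have "smooth_map D\<^sub>A Z2_diffeology (\<lambda>_. e)"
    using e smooth_map_const_discrete[OF A.diffeological_space_axioms, of e "{1, - 1}"]
    by (simp add: Z2_diffeology_def Z2_def)
  then have "smooth_map D\<^sub>A D\<^sub>E (\<lambda>a. \<sigma>h e (\<iota> a))"
    by (rule smooth_map_Z2_action[OF action_lift _ \<iota>])
  then show "smooth_map D\<^sub>A D\<^sub>A (\<lambda>a. inv_into (carrier A) \<iota> (\<sigma>h e (\<iota> a)))"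
    using \<sigma>h_preserves_image[OF e] image_\<iota> A.points_eq_carrier
    by (intro smooth_map_into_A A.diffeological_space_axioms) auto
qed (simp_all add: A.diffeological_space_axioms A.points_eq_carrier restrict_along_def)

lemma diffeomorphism_twist:
  assumes e: "e \<in> carrier Z2"
  shows "diffeomorphism D\<^sub>A D\<^sub>A (twist e)"
proof -
  \<comment> \<open>Every element of the acting group is an involution, so \<open>twist e\<close> is its own inverse.\<close>
  have "twist e a = inv_into (points D\<^sub>A) (twist e) a" if "a \<in> points D\<^sub>A" for a
  proof -
    have "twist e (twist e a) = a" "twist e a \<in> points D\<^sub>A"
      using that e by (simp_all add: A.points_eq_carrier twist_involution twist_closed)
    then show ?thesis
      using bij_betw_twist[OF e] by (metis A.points_eq_carrier bij_betw_inv_into_left)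
  qed
  then have "smooth_map D\<^sub>A D\<^sub>A (inv_into (points D\<^sub>A) (twist e))"
    by (rule smooth_map_cong[OF A.diffeological_space_axioms A.diffeological_space_axioms
          smooth_twist[OF e]])
  then show ?thesis
    using bij_betw_twist[OF e] smooth_twist[OF e]
    by (simp add: diffeomorphism_def A.points_eq_carrier)
qed

lemma local_system_twisted_gluing:
  assumes "cech_Z2_1_cocycle X I U \<epsilon>"
    and \<epsilon>: "\<And>i j x. i \<in> I \<Longrightarrow> j \<in> I \<Longrightarrow> x \<in> U i \<inter> U j \<Longrightarrow> \<epsilon> i j x \<in> carrier Z2"
  shows "local_system X I U A D\<^sub>A (twisted_gluing A \<iota> \<sigma>h \<epsilon>)"
  unfolding local_system_def
proof (intro conjI ballI)
  fix i j assume ij: "i \<in> I" "j \<in> I"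
  have "smooth_map (subspace_diffeology X (U i \<inter> U j)) Z2_diffeology (\<epsilon> i j)"
    using assms(1) ij by (simp add: cech_Z2_1_cocycle_def)
  moreover have "smooth_map Z2_diffeology
      (discrete_diffeology {\<tau> \<in> auto A. diffeomorphism D\<^sub>A D\<^sub>A \<tau>}) (\<lambda>e. twist e)"
    unfolding Z2_diffeology_def
    by (rule smooth_map_discrete) (auto simp: twist_auto diffeomorphism_twist Z2_def)
  ultimately have "smooth_map (subspace_diffeology X (U i \<inter> U j))
      (discrete_diffeology {\<tau> \<in> auto A. diffeomorphism D\<^sub>A D\<^sub>A \<tau>}) (\<lambda>x. twist (\<epsilon> i j x))"
    by (rule smooth_map_compose)
  then show "smooth_map (subspace_diffeology X (U i \<inter> U j))
      (discrete_diffeology {\<tau> \<in> auto A. diffeomorphism D\<^sub>A D\<^sub>A \<tau>}) (twisted_gluing A \<iota> \<sigma>h \<epsilon> i j)"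
    by (simp add: twisted_gluing_def)
next
  fix i j k x a
  assume *: "i \<in> I" "j \<in> I" "k \<in> I" "x \<in> U i \<inter> U j \<inter> U k" "a \<in> carrier A"
  then have "\<epsilon> i k x = \<epsilon> i j x * \<epsilon> j k x" "\<epsilon> i j x \<in> carrier Z2" "\<epsilon> j k x \<in> carrier Z2"
    using assms(1) \<epsilon> by (simp_all add: cech_Z2_1_cocycle_def)
  then show "twisted_gluing A \<iota> \<sigma>h \<epsilon> i j x (twisted_gluing A \<iota> \<sigma>h \<epsilon> j k x a)
      = twisted_gluing A \<iota> \<sigma>h \<epsilon> i k x a"
    using *(5) by (simp add: twisted_gluing_def twist_mult)
qed

text \<open>
  The algebra at a single point: writing \<open>c\<close> for \<open>\<iota> a\<close>, the defects are characterised by \<open>c\<^sub>i\<^sub>j\<^sub>k g\<^sub>i\<^sub>k = g\<^sub>i\<^sub>j s\<^sub>i\<^sub>j(g\<^sub>j\<^sub>k)\<close>, and the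
  images in \<open>E\<close> of both sides of the conclusion, multiplied by \<open>g\<^sub>i\<^sub>l\<close>, are the two bracketings of
  \<open>g\<^sub>i\<^sub>j s\<^sub>i\<^sub>j(g\<^sub>j\<^sub>k) s\<^sub>i\<^sub>j(s\<^sub>j\<^sub>k(g\<^sub>k\<^sub>l))\<close>.
\<close>

lemma twisted_coboundary:
  assumes e: "e\<^sub>i\<^sub>j \<in> carrier Z2" "e\<^sub>j\<^sub>k \<in> carrier Z2"
    and g: "g\<^sub>i\<^sub>j \<in> carrier E" "g\<^sub>j\<^sub>k \<in> carrier E" "g\<^sub>k\<^sub>l \<in> carrier E"
      "g\<^sub>i\<^sub>k \<in> carrier E" "g\<^sub>j\<^sub>l \<in> carrier E" "g\<^sub>i\<^sub>l \<in> carrier E"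
    and a: "a\<^sub>i\<^sub>j\<^sub>k \<in> carrier A" "a\<^sub>i\<^sub>k\<^sub>l \<in> carrier A" "a\<^sub>j\<^sub>k\<^sub>l \<in> carrier A" "a\<^sub>i\<^sub>j\<^sub>l \<in> carrier A"
    and ijk: "\<iota> a\<^sub>i\<^sub>j\<^sub>k \<otimes>\<^bsub>E\<^esub> g\<^sub>i\<^sub>k = g\<^sub>i\<^sub>j \<otimes>\<^bsub>E\<^esub> \<sigma>h e\<^sub>i\<^sub>j g\<^sub>j\<^sub>k"
    and ikl: "\<iota> a\<^sub>i\<^sub>k\<^sub>l \<otimes>\<^bsub>E\<^esub> g\<^sub>i\<^sub>l = g\<^sub>i\<^sub>k \<otimes>\<^bsub>E\<^esub> \<sigma>h (e\<^sub>i\<^sub>j * e\<^sub>j\<^sub>k) g\<^sub>k\<^sub>l"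
    and jkl: "\<iota> a\<^sub>j\<^sub>k\<^sub>l \<otimes>\<^bsub>E\<^esub> g\<^sub>j\<^sub>l = g\<^sub>j\<^sub>k \<otimes>\<^bsub>E\<^esub> \<sigma>h e\<^sub>j\<^sub>k g\<^sub>k\<^sub>l"
    and ijl: "\<iota> a\<^sub>i\<^sub>j\<^sub>l \<otimes>\<^bsub>E\<^esub> g\<^sub>i\<^sub>l = g\<^sub>i\<^sub>j \<otimes>\<^bsub>E\<^esub> \<sigma>h e\<^sub>i\<^sub>j g\<^sub>j\<^sub>l"
  shows "a\<^sub>i\<^sub>j\<^sub>k \<otimes>\<^bsub>A\<^esub> a\<^sub>i\<^sub>k\<^sub>l = twist e\<^sub>i\<^sub>j a\<^sub>j\<^sub>k\<^sub>l \<otimes>\<^bsub>A\<^esub> a\<^sub>i\<^sub>j\<^sub>l"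
proof (rule \<iota>_eqD)
  let ?s = "\<sigma>h e\<^sub>i\<^sub>j"
  let ?t = "twist e\<^sub>i\<^sub>j a\<^sub>j\<^sub>k\<^sub>l"
  have closed: "?s x \<in> carrier E" "\<sigma>h e\<^sub>j\<^sub>k x \<in> carrier E" if "x \<in> carrier E" for x
    using e that \<sigma>h_closed by auto
  have t: "?t \<in> carrier A" "\<iota> ?t = ?s (\<iota> a\<^sub>j\<^sub>k\<^sub>l)"
    using e a by (simp_all add: twist_closed \<iota>_twist)
  have s_hom: "?s (x \<otimes>\<^bsub>E\<^esub> y) = ?s x \<otimes>\<^bsub>E\<^esub> ?s y" if "x \<in> carrier E" "y \<in> carrier E" for x y
    using Z2_action_hom[OF action_lift e(1)] that by simp
  have "\<iota> (a\<^sub>i\<^sub>j\<^sub>k \<otimes>\<^bsub>A\<^esub> a\<^sub>i\<^sub>k\<^sub>l) \<otimes>\<^bsub>E\<^esub> g\<^sub>i\<^sub>l = \<iota> a\<^sub>i\<^sub>j\<^sub>k \<otimes>\<^bsub>E\<^esub> (g\<^sub>i\<^sub>k \<otimes>\<^bsub>E\<^esub> ?s (\<sigma>h e\<^sub>j\<^sub>k g\<^sub>k\<^sub>l))"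
    using a g e ikl by (simp add: E.m_assoc Z2_action_mult[OF action_lift])
  also have "\<dots> = (\<iota> a\<^sub>i\<^sub>j\<^sub>k \<otimes>\<^bsub>E\<^esub> g\<^sub>i\<^sub>k) \<otimes>\<^bsub>E\<^esub> ?s (\<sigma>h e\<^sub>j\<^sub>k g\<^sub>k\<^sub>l)"
    using a g by (simp add: E.m_assoc closed)
  also have "\<dots> = g\<^sub>i\<^sub>j \<otimes>\<^bsub>E\<^esub> (?s g\<^sub>j\<^sub>k \<otimes>\<^bsub>E\<^esub> ?s (\<sigma>h e\<^sub>j\<^sub>k g\<^sub>k\<^sub>l))"
    using g by (simp add: ijk E.m_assoc closed)
  also have "?s g\<^sub>j\<^sub>k \<otimes>\<^bsub>E\<^esub> ?s (\<sigma>h e\<^sub>j\<^sub>k g\<^sub>k\<^sub>l) = \<iota> ?t \<otimes>\<^bsub>E\<^esub> ?s g\<^sub>j\<^sub>l"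
    using a g jkl t by (simp add: closed flip: s_hom)
  also have "g\<^sub>i\<^sub>j \<otimes>\<^bsub>E\<^esub> (\<iota> ?t \<otimes>\<^bsub>E\<^esub> ?s g\<^sub>j\<^sub>l) = (g\<^sub>i\<^sub>j \<otimes>\<^bsub>E\<^esub> \<iota> ?t) \<otimes>\<^bsub>E\<^esub> ?s g\<^sub>j\<^sub>l"
    using g t(1) by (simp add: E.m_assoc closed)
  also have "\<dots> = (\<iota> ?t \<otimes>\<^bsub>E\<^esub> g\<^sub>i\<^sub>j) \<otimes>\<^bsub>E\<^esub> ?s g\<^sub>j\<^sub>l"
    using g t(1) by (simp only: central[OF t(1) g(1)])
  also have "\<dots> = \<iota> ?t \<otimes>\<^bsub>E\<^esub> (\<iota> a\<^sub>i\<^sub>j\<^sub>l \<otimes>\<^bsub>E\<^esub> g\<^sub>i\<^sub>l)"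
    using g t(1) by (simp add: ijl E.m_assoc closed)
  also have "\<dots> = \<iota> (?t \<otimes>\<^bsub>A\<^esub> a\<^sub>i\<^sub>j\<^sub>l) \<otimes>\<^bsub>E\<^esub> g\<^sub>i\<^sub>l"
    using a g t(1) by (simp add: E.m_assoc)
  finally show "\<iota> (a\<^sub>i\<^sub>j\<^sub>k \<otimes>\<^bsub>A\<^esub> a\<^sub>i\<^sub>k\<^sub>l) = \<iota> (?t \<otimes>\<^bsub>A\<^esub> a\<^sub>i\<^sub>j\<^sub>l)"
    using a g t(1) by simp
qed (use a e twist_closed in auto)

end

section \<open>Transition functions of a principal bundle\<close>

lemma transition_functionsD:
  assumes "transition_functions H D\<^sub>H P X \<pi> act I U \<phi> h"
  shows "i \<in> I \<Longrightarrow> local_trivialization H D\<^sub>H P X \<pi> act (U i) (\<phi> i)"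
    and "i \<in> I \<Longrightarrow> j \<in> I \<Longrightarrow> x \<in> U i \<inter> U j \<Longrightarrow> h i j x \<in> carrier H"
    and "i \<in> I \<Longrightarrow> j \<in> I \<Longrightarrow> x \<in> U i \<inter> U j \<Longrightarrow> y \<in> carrier H \<Longrightarrow>
      \<phi> j (x, y) = \<phi> i (x, h i j x \<otimes>\<^bsub>H\<^esub> y)"
  using assms unfolding transition_functions_def by blast+

text \<open>
  Along the unit section, \<open>\<phi>\<^sub>j(x, 1) = \<phi>\<^sub>i(x, h\<^sub>i\<^sub>j(x))\<close>; hence \<open>h\<^sub>i\<^sub>j(x)\<close> is the group component of
  \<open>\<phi>\<^sub>i\<^sup>-\<^sup>1(\<phi>\<^sub>j(x, 1))\<close>, a composite of smooth maps.
\<close>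

lemma transition_function_smooth:
  assumes "principal_bundle H D\<^sub>H P X \<pi> act"
    and "transition_functions H D\<^sub>H P X \<pi> act I U \<phi> h"
    and ij: "i \<in> I" "j \<in> I" and U: "U i \<subseteq> points X"
  shows "smooth_map (subspace_diffeology X (U i \<inter> U j)) D\<^sub>H (h i j)"
proof -
  interpret H: diffeological_group H D\<^sub>H
    using assms(1) by (simp add: principal_bundle_def)
  have X: "diffeological_space X"
    using assms(1) by (simp add: principal_bundle_def)
  let ?S = "subspace_diffeology X (U i \<inter> U j)"
  have S: "diffeological_space ?S"
    by (rule diffeological_space_subspace[OF X])
  have pointsS: "points ?S = U i \<inter> U j"
    using U by (auto simp: subspace_diffeology_def)
  let ?T = "\<lambda>i. prod_diffeology (subspace_diffeology X (U i)) D\<^sub>H"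
  let ?P = "\<lambda>i. subspace_diffeology P {p. \<pi> p \<in> U i}"
  note triv = transition_functionsD(1)[OF assms(2)]
  have trans: "h i j x \<in> carrier H" "\<phi> j (x, \<one>\<^bsub>H\<^esub>) = \<phi> i (x, h i j x)" if "x \<in> U i \<inter> U j" for x
    using transition_functionsD(2)[OF assms(2) ij that]
      transition_functionsD(3)[OF assms(2) ij that H.one_closed] by simp_all
  have "smooth_map ?S (?T j) (\<lambda>x. (x, \<one>\<^bsub>H\<^esub>))"
    by (intro smooth_map_Pair smooth_map_const S H.diffeological_space_axioms
        smooth_map_subspace_mono[OF smooth_map_id]) (auto simp: H.points_eq_carrier)
  moreover have "smooth_map (?T j) (?P j) (\<phi> j)"
    using triv[OF ij(2)] by (simp add: local_trivialization_def diffeomorphism_def)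
  ultimately have "smooth_map ?S (?P j) (\<lambda>x. \<phi> j (x, \<one>\<^bsub>H\<^esub>))"
    by (rule smooth_map_compose)
  then have "smooth_map ?S P (\<lambda>x. \<phi> j (x, \<one>\<^bsub>H\<^esub>))"
    by (rule smooth_map_compose[OF _ smooth_map_subspace_inclusion])
  moreover have "\<pi> (\<phi> j (x, \<one>\<^bsub>H\<^esub>)) \<in> U i" if "x \<in> U i \<inter> U j" for x
    using triv[OF ij(2)] that by (simp add: local_trivialization_def)
  ultimately have "smooth_map ?S (?P i) (\<lambda>x. \<phi> j (x, \<one>\<^bsub>H\<^esub>))"
    by (intro smooth_map_into_subspace[OF S]) (auto simp: pointsS)
  moreover have "smooth_map (?P i) (?T i) (inv_into (points (?T i)) (\<phi> i))"
    using triv[OF ij(1)] by (simp add: local_trivialization_def diffeomorphism_def)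
  ultimately have "smooth_map ?S (?T i) (\<lambda>x. inv_into (points (?T i)) (\<phi> i) (\<phi> j (x, \<one>\<^bsub>H\<^esub>)))"
    by (rule smooth_map_compose)
  then have "smooth_map ?S D\<^sub>H (\<lambda>x. snd (inv_into (points (?T i)) (\<phi> i) (\<phi> j (x, \<one>\<^bsub>H\<^esub>))))"
    by (rule smooth_map_compose[OF _ smooth_map_snd])
  then show ?thesis
  proof (rule smooth_map_cong[OF S H.diffeological_space_axioms])
    fix x assume "x \<in> points ?S"
    then have x: "x \<in> U i \<inter> U j"
      by (simp add: pointsS)
    have "inj_on (\<phi> i) (points (?T i))"
      using triv[OF ij(1)] by (simp add: local_trivialization_def diffeomorphism_def bij_betw_def)
    moreover have "(x, h i j x) \<in> points (?T i)"
      using x U trans by (auto simp: prod_diffeology_def subspace_diffeology_def H.points_eq_carrier)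
    ultimately show "snd (inv_into (points (?T i)) (\<phi> i) (\<phi> j (x, \<one>\<^bsub>H\<^esub>))) = h i j x"
      using trans(2)[OF x] by simp
  qed
qed

lemma transition_function_cocycle:
  assumes "principal_bundle H D\<^sub>H P X \<pi> act"
    and "transition_functions H D\<^sub>H P X \<pi> act I U \<phi> h"
    and ijk: "i \<in> I" "j \<in> I" "k \<in> I" and U: "U i \<subseteq> points X" and x: "x \<in> U i \<inter> U j \<inter> U k"
  shows "h i j x \<otimes>\<^bsub>H\<^esub> h j k x = h i k x"
proof -
  interpret H: diffeological_group H D\<^sub>H
    using assms(1) by (simp add: principal_bundle_def)
  let ?T = "prod_diffeology (subspace_diffeology X (U i)) D\<^sub>H"
  have h: "h i j x \<in> carrier H" "h j k x \<in> carrier H" "h i k x \<in> carrier H"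
    using transition_functionsD(2)[OF assms(2), where x = x] ijk x by auto
  have trans: "\<phi> b (x, y) = \<phi> a (x, h a b x \<otimes>\<^bsub>H\<^esub> y)"
    if "a \<in> {i, j, k}" "b \<in> {i, j, k}" "y \<in> carrier H" for a b y
    by (rule transition_functionsD(3)[OF assms(2)]) (use ijk x that in auto)
  have "\<phi> i (x, h i j x \<otimes>\<^bsub>H\<^esub> h j k x) = \<phi> j (x, h j k x)"
    using trans[of i j "h j k x"] h by simp
  also have "\<dots> = \<phi> k (x, \<one>\<^bsub>H\<^esub>)"
    using trans[of j k "\<one>\<^bsub>H\<^esub>"] h by simp
  also have "\<dots> = \<phi> i (x, h i k x)"
    using trans[of i k "\<one>\<^bsub>H\<^esub>"] h by simp
  finally have "\<phi> i (x, h i j x \<otimes>\<^bsub>H\<^esub> h j k x) = \<phi> i (x, h i k x)" .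
  moreover have "inj_on (\<phi> i) (points ?T)"
    using transition_functionsD(1)[OF assms(2) ijk(1)]
    by (simp add: local_trivialization_def diffeomorphism_def bij_betw_def)
  moreover have "(x, h i j x \<otimes>\<^bsub>H\<^esub> h j k x) \<in> points ?T" "(x, h i k x) \<in> points ?T"
    using x U h by (auto simp: prod_diffeology_def subspace_diffeology_def H.points_eq_carrier)
  ultimately show ?thesis
    by (auto dest: inj_onD)
qed

section \<open>The lifting cocycle\<close>

theorem theorem6p3:
  fixes A :: "'a monoid" and D\<^sub>A :: "'a diffeology"
    and Gh :: "'e monoid" and D\<^sub>G\<^sub>h :: "'e diffeology"
    and G :: "'g monoid" and D\<^sub>G :: "'g diffeology"
    and \<iota> :: "'a \<Rightarrow> 'e" and q :: "'e \<Rightarrow> 'g"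
    and \<sigma> :: "int \<Rightarrow> 'g \<Rightarrow> 'g" and \<sigma>h :: "int \<Rightarrow> 'e \<Rightarrow> 'e"
    and X :: "'x diffeology" and P :: "'p diffeology"
    and \<pi> :: "'p \<Rightarrow> 'x" and act :: "'p \<Rightarrow> 'g \<times> int \<Rightarrow> 'p"
    and I :: "'i set" and U :: "'i \<Rightarrow> 'x set"
    and \<phi> :: "'i \<Rightarrow> 'x \<times> ('g \<times> int) \<Rightarrow> 'p"
    and g :: "'i \<Rightarrow> 'i \<Rightarrow> 'x \<Rightarrow> 'g" and \<epsilon> :: "'i \<Rightarrow> 'i \<Rightarrow> 'x \<Rightarrow> int"
    and gh :: "'i \<Rightarrow> 'i \<Rightarrow> 'x \<Rightarrow> 'e"
  assumes extension: "central_extension A D\<^sub>A Gh D\<^sub>G\<^sub>h G D\<^sub>G \<iota> q"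
    and action: "smooth_Z2_action G D\<^sub>G \<sigma>"
    and action_lift: "smooth_Z2_action Gh D\<^sub>G\<^sub>h \<sigma>h"
    and equivariant: "\<forall>e\<in>carrier Z2. \<forall>y\<in>carrier Gh. q (\<sigma>h e y) = \<sigma> e (q y)"
    and principal: "principal_bundle (semidirect_Z2 G \<sigma>) (semidirect_Z2_diffeology D\<^sub>G) P X \<pi> act"
    and cover: "good_cover X I U"
    and transition: "transition_functions (semidirect_Z2 G \<sigma>) (semidirect_Z2_diffeology D\<^sub>G) P X \<pi> act
                       I U \<phi> (\<lambda>i j x. (g i j x, \<epsilon> i j x))"
    and lifts_smooth: "\<forall>i\<in>I. \<forall>j\<in>I. smooth_map (subspace_diffeology X (U i \<inter> U j)) D\<^sub>G\<^sub>h (gh i j)"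
    and lifts: "\<forall>i\<in>I. \<forall>j\<in>I. \<forall>x\<in>U i \<inter> U j. q (gh i j x) = g i j x"
  shows "cech_Z2_1_cocycle X I U \<epsilon> \<and> local_system X I U A D\<^sub>A (twisted_gluing A \<iota> \<sigma>h \<epsilon>) \<and>
    (\<exists>a. (\<forall>i\<in>I. \<forall>j\<in>I. \<forall>k\<in>I. \<forall>x\<in>U i \<inter> U j \<inter> U k.
             \<iota> (a i j k x) = gh i j x \<otimes>\<^bsub>Gh\<^esub> \<sigma>h (\<epsilon> i j x) (gh j k x) \<otimes>\<^bsub>Gh\<^esub> inv\<^bsub>Gh\<^esub> (gh i k x)) \<and>
         cech_2_cocycle X I U A D\<^sub>A (twisted_gluing A \<iota> \<sigma>h \<epsilon>) a)"
proof -
  interpret Z2_equivariant_central_extension A D\<^sub>A Gh D\<^sub>G\<^sub>h G D\<^sub>G \<iota> q \<sigma> \<sigma>h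
    using extension action action_lift equivariant by unfold_locales auto
  have X: "diffeological_space X"
    using principal by (simp add: principal_bundle_def)
  have U: "U i \<subseteq> points X" if "i \<in> I" for i
    using cover that by (simp add: good_cover_def D_open_def)
  let ?\<theta> = "twisted_gluing A \<iota> \<sigma>h \<epsilon>"

  have g: "g i j x \<in> carrier G" and \<epsilon>: "\<epsilon> i j x \<in> carrier Z2"
    if "i \<in> I" "j \<in> I" "x \<in> U i \<inter> U j" for i j x
    using transition_functionsD(2)[OF transition that] by (simp_all add: semidirect_Z2_def)
  have gh: "gh i j x \<in> carrier Gh" if "i \<in> I" "j \<in> I" "x \<in> U i \<inter> U j" for i j x
    using smooth_mapD(1)[OF lifts_smooth[rule_format, OF that(1,2)], of x] that U
    by (auto simp: subspace_diffeology_def E.points_eq_carrier)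

  have h_cocycle: "g i j x \<otimes>\<^bsub>G\<^esub> \<sigma> (\<epsilon> i j x) (g j k x) = g i k x" "\<epsilon> i j x * \<epsilon> j k x = \<epsilon> i k x"
    if "i \<in> I" "j \<in> I" "k \<in> I" "x \<in> U i \<inter> U j \<inter> U k" for i j k x
    using transition_function_cocycle[OF principal transition that(1-3) U[OF that(1)] that(4)]
    by (simp_all add: semidirect_Z2_def)
  have \<epsilon>_smooth: "smooth_map (subspace_diffeology X (U i \<inter> U j)) Z2_diffeology (\<epsilon> i j)"
    if "i \<in> I" "j \<in> I" for i j
    using smooth_map_compose[OF transition_function_smooth[OF principal transition that U[OF that(1)],
          unfolded semidirect_Z2_diffeology_def] smooth_map_snd]
    by simp
  have cech1: "cech_Z2_1_cocycle X I U \<epsilon>"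
    using \<epsilon>_smooth h_cocycle(2) by (simp add: cech_Z2_1_cocycle_def)

  define c where "c i j k x = gh i j x \<otimes>\<^bsub>Gh\<^esub> \<sigma>h (\<epsilon> i j x) (gh j k x) \<otimes>\<^bsub>Gh\<^esub> inv\<^bsub>Gh\<^esub> (gh i k x)"
    for i j k x
  define a where "a i j k x = inv_into (carrier A) \<iota> (c i j k x)" for i j k x
  have c: "c i j k x \<in> carrier Gh" "q (c i j k x) = \<one>\<^bsub>G\<^esub>"
    "c i j k x \<otimes>\<^bsub>Gh\<^esub> gh i k x = gh i j x \<otimes>\<^bsub>Gh\<^esub> \<sigma>h (\<epsilon> i j x) (gh j k x)"
    if ijk: "i \<in> I" "j \<in> I" "k \<in> I" and x: "x \<in> U i \<inter> U j \<inter> U k" for i j k x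
  proof -
    have mem: "gh i j x \<in> carrier Gh" "\<sigma>h (\<epsilon> i j x) (gh j k x) \<in> carrier Gh" "gh i k x \<in> carrier Gh"
      using ijk x by (auto intro!: gh \<epsilon> \<sigma>h_closed)
    then show "c i j k x \<in> carrier Gh"
      "c i j k x \<otimes>\<^bsub>Gh\<^esub> gh i k x = gh i j x \<otimes>\<^bsub>Gh\<^esub> \<sigma>h (\<epsilon> i j x) (gh j k x)"
      by (simp_all add: c_def E.m_assoc)
    have "q (c i j k x) = g i j x \<otimes>\<^bsub>G\<^esub> \<sigma> (\<epsilon> i j x) (g j k x) \<otimes>\<^bsub>G\<^esub> inv\<^bsub>G\<^esub> (g i k x)"
      using ijk x mem gh \<epsilon> lifts unfolding c_def by (simp add: equivariant[rule_format])
    then show "q (c i j k x) = \<one>\<^bsub>G\<^esub>"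
      using ijk x g by (simp add: h_cocycle)
  qed
  have \<iota>a: "\<iota> (a i j k x) = c i j k x" and aA: "a i j k x \<in> carrier A"
    if "i \<in> I" "j \<in> I" "k \<in> I" "x \<in> U i \<inter> U j \<inter> U k" for i j k x
  proof -
    have "c i j k x \<in> \<iota> ` carrier A"
      using c(1,2)[OF that] by (simp add: image_\<iota>)
    then show "\<iota> (a i j k x) = c i j k x" "a i j k x \<in> carrier A"
      by (simp_all add: a_def f_inv_into_f inv_into_into)
  qed

  have "cech_2_cocycle X I U A D\<^sub>A ?\<theta> a"
    unfolding cech_2_cocycle_def
  proof (intro conjI ballI)
    fix i j k assume ijk: "i \<in> I" "j \<in> I" "k \<in> I"
    let ?S = "subspace_diffeology X (U i \<inter> U j \<inter> U k)"
    have S: "diffeological_space ?S"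
      by (rule diffeological_space_subspace[OF X])
    have mult: "smooth_map ?S D\<^sub>G\<^sub>h (\<lambda>x. f x \<otimes>\<^bsub>Gh\<^esub> f' x)"
      if "smooth_map ?S D\<^sub>G\<^sub>h f" "smooth_map ?S D\<^sub>G\<^sub>h f'" for f f'
      using smooth_map_compose[OF smooth_map_Pair[OF that] E.smooth_mult] by simp
    have restr: "smooth_map ?S D\<^sub>G\<^sub>h (gh i j)" "smooth_map ?S D\<^sub>G\<^sub>h (gh j k)"
      "smooth_map ?S D\<^sub>G\<^sub>h (gh i k)" "smooth_map ?S Z2_diffeology (\<epsilon> i j)"
      using ijk by (auto intro: smooth_map_subspace_mono lifts_smooth[rule_format] \<epsilon>_smooth)
    have "smooth_map ?S D\<^sub>G\<^sub>h (c i j k)"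
      unfolding c_def
      by (intro mult smooth_map_Z2_action[OF action_lift] smooth_map_compose[OF _ E.smooth_inv] restr)
    then show "smooth_map ?S D\<^sub>A (a i j k)"
      unfolding a_def using c(2)[OF ijk]
      by (intro smooth_map_into_A[OF S]) (auto simp: subspace_diffeology_def)
  next
    fix i j k l x
    assume idx: "i \<in> I" "j \<in> I" "k \<in> I" "l \<in> I" and x: "x \<in> U i \<inter> U j \<inter> U k \<inter> U l"
    show "a i j k x \<otimes>\<^bsub>A\<^esub> a i k l x = ?\<theta> i j x (a j k l x) \<otimes>\<^bsub>A\<^esub> a i j l x"
      unfolding twisted_gluing_def
      by (rule twisted_coboundary[where e\<^sub>j\<^sub>k = "\<epsilon> j k x" and g\<^sub>i\<^sub>j = "gh i j x" and g\<^sub>j\<^sub>k = "gh j k x"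
            and g\<^sub>k\<^sub>l = "gh k l x" and g\<^sub>i\<^sub>k = "gh i k x" and g\<^sub>j\<^sub>l = "gh j l x" and g\<^sub>i\<^sub>l = "gh i l x"])
        (use idx x in \<open>auto simp: \<iota>a c(3) h_cocycle intro: aA gh \<epsilon>\<close>)
  qed
  with \<iota>a cech1 local_system_twisted_gluing[OF cech1 \<epsilon>] show ?thesis
    unfolding c_def by blast
qed

end
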